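(* Consider a water distribution system (WDS), and let $\mathcal{N}_r\subset\mathcal{N}$ be a nonempty subset of nodes. Given: i) the pressures $h_i$ for all $i\in\mathcal{N}_r$; ii) the injections $d_i$ for all $i\in\mathcal{N}\setminus\mathcal{N}_r$; and iii) the statuses and speeds of all pumps; the set of water flow (WF) equations has at most one solution $(\mathbf{d},\mathbf{f},\mathbf{h})$ that agrees with the given data.
   Context: A water distribution system (WDS) is a finite connected directed graph $\mathcal{G}=(\mathcal{N},\mathcal{P})$ with $\mathcal{N}=\{1,\dots,N\}$ and $P=|\mathcal{P}|$; the direction of an edge is only a reference direction for its flow. The edge set is partitioned into pumps $\mathcal{P}_a\subset\mathcal{P}$ and lossy pipes $\bar{\mathcal{P}}_a=\mathcal{P}\setminus\mathcal{P}_a$. The edge-node incidence matrix $\mathbf{A}\in\mathbb{R}^{P\times N}$ has, for each edge $p=(m,n)$, entries $A_{p,m}=+1$, $A_{p,n}=-1$ and $A_{p,k}=0$ for the other $k$. Vectors: injections $\mathbf{d}\in\mathbb{R}^N$, flows $\mathbf{f}\in\mathbb{R}^P$ (with $f_{mn}$ the flow on edge $(m,n)$, possibly negative on lossy pipes), pressures $\mathbf{h}\in\mathbb{R}^N$. The WF equations in $(\mathbf{d},\mathbf{f},\mathbf{h})$ are: (i) $\mathbf{A}^\top\mathbf{f}=\mathbf{d}$; (ii) for every lossy pipe $(m,n)\in\bar{\mathcal{P}}_a$: $h_m-h_n=c_{mn}\,\mathrm{sign}(f_{mn})f_{mn}^2$, where $c_{mn}>0$ is a constant and $\mathrm{sign}(0)=0$;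 (iii) for every pump $(m,n)\in\mathcal{P}_a$: $h_n-h_m=\lambda_{mn}f_{mn}^2+\bar\mu_{mn}f_{mn}+\bar\nu_{mn}$, with flow in the operating range $0\le\underline{f}_{mn}\le f_{mn}\le\bar f_{mn}$. Here the unknowns are $\mathbf{f}$, the pressures at nodes outside $\mathcal{N}_r$, and the injections at nodes in $\mathcal{N}_r$. Pump parameters: $\lambda_{mn}<0$, $\bar\mu_{mn}=\mu_{mn}\omega^0_{mn}$, $\bar\nu_{mn}=\nu_{mn}(\omega^0_{mn})^2$, where $\mu_{mn},\nu_{mn}\ge0$ are known constants and $\omega^0_{mn}$ is the given pump speed; they satisfy $2\lambda_{mn}\underline{f}_{mn}+\bar\mu_{mn}<0$, so that the pressure gain is strictly decreasing in $f_{mn}$ on $[\underline{f}_{mn},\bar f_{mn}]$. All pumps in $\mathcal{P}_a$ are running (a pump that is off is removed by merging its end nodes, or treated as a lossy pipe). *)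

theory Defs
  imports
    Complex_Main
    "HOL-Library.FuncSet"
    "Graph_Theory.Digraph_Component"
begin

text \<open>
  Edges are ordered pairs \<open>(m, n)\<close>; vectors indexed by nodes or edges are functions
  on the respective finite set, extended by \<open>undefined\<close> outside it (\<open>\<rightarrow>\<^sub>E\<close>), so that
  equality of vectors is equality of functions.
\<close>

record 'v wds =
  network :: "'v pair_pre_digraph"
  pumps :: "('v \<times> 'v) set"
  loss_coeff :: "'v \<times> 'v \<Rightarrow> real"
  pump_lambda :: "'v \<times> 'v \<Rightarrow> real"
  pump_mu :: "'v \<times> 'v \<Rightarrow> real"
  pump_nu :: "'v \<times> 'v \<Rightarrow> real"
  pump_speed :: "'v \<times> 'v \<Rightarrow> real"
  flow_min :: "'v \<times> 'v \<Rightarrow> real"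
  flow_max :: "'v \<times> 'v \<Rightarrow> real"

abbreviation nodes :: "'v wds \<Rightarrow> 'v set" where
  "nodes W \<equiv> pverts (network W)"

abbreviation edges :: "'v wds \<Rightarrow> ('v \<times> 'v) set" where
  "edges W \<equiv> parcs (network W)"

definition lossy_pipes :: "'v wds \<Rightarrow> ('v \<times> 'v) set" where
  "lossy_pipes W = edges W - pumps W"

definition mu_bar :: "'v wds \<Rightarrow> 'v \<times> 'v \<Rightarrow> real" where
  "mu_bar W p = pump_mu W p * pump_speed W p"

definition nu_bar :: "'v wds \<Rightarrow> 'v \<times> 'v \<Rightarrow> real" where
  "nu_bar W p = pump_nu W p * (pump_speed W p)\<^sup>2"

text \<open>
  The locale \<open>pair_digraph\<close> provides finiteness and the absence of self-loops (without
  which the two nonzero entries of an incidence row would clash); \<open>connected\<close> ignores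
  the edge directions and includes that there is at least one node.
\<close>

locale water_distribution_system =
  fixes W :: "'v wds"
  assumes digraph: "pair_digraph (network W)"
    and connected: "connected (with_proj (network W))"
    and pumps_subset: "pumps W \<subseteq> edges W"
    and loss_coeff_pos: "p \<in> lossy_pipes W \<Longrightarrow> loss_coeff W p > 0"
    and pump_lambda_neg: "p \<in> pumps W \<Longrightarrow> pump_lambda W p < 0"
    and pump_mu_nonneg: "p \<in> pumps W \<Longrightarrow> pump_mu W p \<ge> 0"
    and pump_nu_nonneg: "p \<in> pumps W \<Longrightarrow> pump_nu W p \<ge> 0"
    and flow_min_nonneg: "p \<in> pumps W \<Longrightarrow> flow_min W p \<ge> 0"
    and pump_slope_neg: "p \<in> pumps W \<Longrightarrow> 2 * pump_lambda W p * flow_min W p + mu_bar W p < 0"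

definition incidence :: "'v wds \<Rightarrow> 'v \<times> 'v \<Rightarrow> 'v \<Rightarrow> real" where
  "incidence W p k = (if k = fst p then 1 else if k = snd p then -1 else 0)"

definition wf_solution ::
    "'v wds \<Rightarrow> ('v \<Rightarrow> real) \<Rightarrow> ('v \<times> 'v \<Rightarrow> real) \<Rightarrow> ('v \<Rightarrow> real) \<Rightarrow> bool" where
  "wf_solution W d f h \<longleftrightarrow>
     d \<in> nodes W \<rightarrow>\<^sub>E UNIV \<and> f \<in> edges W \<rightarrow>\<^sub>E UNIV \<and> h \<in> nodes W \<rightarrow>\<^sub>E UNIV \<and>
     (\<forall>k\<in>nodes W. (\<Sum>p\<in>edges W. incidence W p k * f p) = d k) \<and>
     (\<forall>(m, n)\<in>lossy_pipes W.
        h m - h n = loss_coeff W (m, n) * sgn (f (m, n)) * (f (m, n))\<^sup>2) \<and>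
     (\<forall>(m, n)\<in>pumps W.
        h n - h m = pump_lambda W (m, n) * (f (m, n))\<^sup>2 + mu_bar W (m, n) * f (m, n) + nu_bar W (m, n) \<and>
        flow_min W (m, n) \<le> f (m, n) \<and> f (m, n) \<le> flow_max W (m, n))"

end

theory Submission
  imports Defs
begin

text \<open>
  The proof is a monotonicity argument. On every edge \<open>(m, n)\<close> the pressure drop \<open>h m - h n\<close> is a
  strictly increasing function \<open>head_loss W (m, n)\<close> of the flow: a lossy pipe drops
  \<open>c * sgn f * f\<^sup>2 = c * f * \<bar>f\<bar>\<close>, and the negated gain of a pump increases on its operating range,
  because a parabola that opens downwards and has negative slope at \<open>flow_min\<close> decreases from there
  on (lemma \<open>strict_mono_on_head_loss\<close>).

  Take two solutions with the same data and write \<open>\<Delta>\<close> for their difference. Since flow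
  conservation is linear, summation by parts on the graph gives (lemma \<open>power_balance\<close>)
  \[
    \sum_{(m,n)} \Delta f_{mn}\,(\Delta h_m - \Delta h_n) = \sum_k \Delta d_k\,\Delta h_k .
  \]
  The right-hand side vanishes term by term: \<open>\<Delta>h\<close> is zero at the nodes with given pressure and \<open>\<Delta>d\<close>
  at all the others. On the left, strict monotonicity makes every term nonnegative, and positive
  wherever \<open>\<Delta>f \<noteq> 0\<close>. Hence \<open>\<Delta>f = 0\<close> (lemma \<open>wf_solution_flow_unique\<close>). Equal flows have equal
  injections, and they have equal pressure drops on all edges; so \<open>\<Delta>h\<close> is the same at the two ends of
  each edge, thus constant because the network is connected, and it is zero at a node with given
  pressure, of which there is at least one.
\<close>

definition head_loss :: "'v wds \<Rightarrow> 'v \<times> 'v \<Rightarrow> real \<Rightarrow> real" where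
  "head_loss W p x =
     (if p \<in> pumps W then - (pump_lambda W p * x\<^sup>2 + mu_bar W p * x + nu_bar W p)
      else loss_coeff W p * sgn x * x\<^sup>2)"

text \<open>
  A pump's range is the half-line on which its gain decreases: the condition on the slope at
  \<open>flow_min\<close> propagates to all larger flows.
\<close>

definition flow_range :: "'v wds \<Rightarrow> 'v \<times> 'v \<Rightarrow> real set" where
  "flow_range W p = (if p \<in> pumps W then {flow_min W p..} else UNIV)"

lemma strict_mono_signed_square: "strict_mono (\<lambda>x::real. sgn x * x\<^sup>2)"
proof (rule strict_monoI)
  fix x y :: real
  assume "x < y"
  consider "0 \<le> x" | "x < 0" "0 \<le> y" | "y < 0"
    by linarith
  then show "sgn x * x\<^sup>2 < sgn y * y\<^sup>2"
  proof cases
    case 1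
    then have "x\<^sup>2 < y\<^sup>2"
      using \<open>x < y\<close> by (simp add: power_strict_mono)
    then show ?thesis
      using 1 \<open>x < y\<close> by (simp add: sgn_if)
  next
    case 2
    have "sgn x * x\<^sup>2 < 0"
      using 2 by (simp add: sgn_if)
    also have "0 \<le> sgn y * y\<^sup>2"
      using 2 by (simp add: sgn_if)
    finally show ?thesis .
  next
    case 3
    have "(- y)\<^sup>2 < (- x)\<^sup>2"
      using 3 \<open>x < y\<close> by (intro power_strict_mono) auto
    then show ?thesis
      using 3 \<open>x < y\<close> by (simp add: sgn_if)
  qed
qed

lemma concave_quadratic_strict_antimono_on:
  fixes a b c x\<^sub>0 :: real
  assumes "a < 0" and slope: "2 * a * x\<^sub>0 + b < 0"
  shows "strict_antimono_on {x\<^sub>0..} (\<lambda>x. a * x\<^sup>2 + b * x + c)"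
proof (rule monotone_onI)
  fix x y
  assume "x \<in> {x\<^sub>0..}" "y \<in> {x\<^sub>0..}" "x < y"
  then have "a * (x + y) \<le> a * (2 * x\<^sub>0)"
    using \<open>a < 0\<close> by (intro mult_left_mono_neg) auto
  then have "a * (x + y) + b < 0"
    using slope by linarith
  then have "(y - x) * (a * (x + y) + b) < 0"
    using \<open>x < y\<close> by (intro mult_pos_neg) auto
  then show "a * x\<^sup>2 + b * x + c > a * y\<^sup>2 + b * y + c"
    by (simp add: algebra_simps power2_eq_square)
qed

text \<open>
  This turns strict monotonicity into the sign condition on products of differences under which
  a sum of such products vanishes only if each difference does.
\<close>

lemma strict_mono_on_diff_mult_pos:
  fixes g :: "real \<Rightarrow> real"
  assumes "strict_mono_on S g" "x \<in> S" "y \<in> S" "x \<noteq> y"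
  shows "0 < (x - y) * (g x - g y)"
proof (cases "x < y")
  case True
  then show ?thesis
    using strict_mono_onD[OF assms(1), of x y] assms by (intro mult_neg_neg) auto
next
  case False
  then show ?thesis
    using strict_mono_onD[OF assms(1), of y x] assms by (intro mult_pos_pos) auto
qed

context water_distribution_system
begin

sublocale network: pair_digraph "network W"
  by (rule digraph)

lemma strict_mono_on_head_loss:
  assumes "p \<in> edges W"
  shows "strict_mono_on (flow_range W p) (head_loss W p)"
proof (cases "p \<in> pumps W")
  case True
  then have "strict_antimono_on {flow_min W p..}
      (\<lambda>x. pump_lambda W p * x\<^sup>2 + mu_bar W p * x + nu_bar W p)"
    by (intro concave_quadratic_strict_antimono_on pump_lambda_neg pump_slope_neg)
  then show ?thesis
    using True by (fastforce simp: monotone_on_def head_loss_def flow_range_def)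
next
  case False
  then have "0 < loss_coeff W p"
    using assms by (intro loss_coeff_pos) (simp add: lossy_pipes_def)
  then show ?thesis
    using False strict_monoD[OF strict_mono_signed_square]
    by (auto simp: monotone_on_def head_loss_def flow_range_def mult.assoc)
qed

lemma wf_solution_pressure_drop:
  assumes "wf_solution W d f h" "(m, n) \<in> edges W"
  shows "h m - h n = head_loss W (m, n) (f (m, n))"
  using assms by (cases "(m, n) \<in> pumps W")
    (fastforce simp: wf_solution_def head_loss_def lossy_pipes_def)+

lemma wf_solution_flow_range:
  assumes "wf_solution W d f h" "p \<in> edges W"
  shows "f p \<in> flow_range W p"
  using assms by (cases p) (auto simp: wf_solution_def flow_range_def)

text \<open>Absence of self-loops matters here: the row of a loop would sum to \<open>y m\<close> instead of \<open>0\<close>.\<close>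

lemma sum_incidence_row:
  assumes "(m, n) \<in> edges W"
  shows "(\<Sum>k\<in>nodes W. incidence W (m, n) k * y k) = y m - y n"
proof -
  have mn: "m \<in> nodes W" "n \<in> nodes W" "m \<noteq> n"
    using assms network.in_arcsD1 network.in_arcsD2 network.pair_no_loops[OF assms] by auto
  have "(\<Sum>k\<in>nodes W. incidence W (m, n) k * y k)
      = (\<Sum>k\<in>nodes W. (if k = m then y k else 0) - (if k = n then y k else 0))"
    using mn by (intro sum.cong) (auto simp: incidence_def)
  also have "\<dots> = y m - y n"
    using mn network.pair_finite_verts by (simp add: sum_subtractf)
  finally show ?thesis .
qed

lemma power_balance:
  fixes x :: "'v \<times> 'v \<Rightarrow> real" and y :: "'v \<Rightarrow> real"
  shows "(\<Sum>(m, n)\<in>edges W. x (m, n) * (y m - y n))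
    = (\<Sum>k\<in>nodes W. (\<Sum>p\<in>edges W. incidence W p k * x p) * y k)"
proof -
  have "(\<Sum>(m, n)\<in>edges W. x (m, n) * (y m - y n))
      = (\<Sum>p\<in>edges W. \<Sum>k\<in>nodes W. incidence W p k * x p * y k)"
    by (intro sum.cong)
      (auto simp: sum_incidence_row[symmetric] sum_distrib_left mult_ac)
  also have "\<dots> = (\<Sum>k\<in>nodes W. (\<Sum>p\<in>edges W. incidence W p k * x p) * y k)"
    by (subst sum.swap) (simp add: sum_distrib_right)
  finally show ?thesis .
qed

text \<open>
  The hypothesis relating \<open>d\<close> to \<open>h\<close> makes the nodal side of the power balance of the differences
  vanish term by term; on the edge side all terms are nonnegative, so each of them is zero.
\<close>

lemma wf_solution_flow_unique:
  assumes sol: "wf_solution W d f h" and sol': "wf_solution W d' f' h'"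
    and data: "\<And>k. k \<in> nodes W \<Longrightarrow> d k = d' k \<or> h k = h' k"
  shows "f = f'"
proof (rule extensionalityI)
  show "f \<in> extensional (edges W)" "f' \<in> extensional (edges W)"
    using sol sol' by (auto simp: wf_solution_def PiE_def)
  let ?F = "\<lambda>p. f p - f' p" and ?H = "\<lambda>k. h k - h' k"
  let ?t = "\<lambda>(m, n). ?F (m, n) * (?H m - ?H n)"
  have pos: "0 < ?t p" if p: "p \<in> edges W" and "f p \<noteq> f' p" for p
  proof -
    obtain m n where mn: "p = (m, n)"
      by (cases p)
    have "?H m - ?H n = head_loss W p (f p) - head_loss W p (f' p)"
      using wf_solution_pressure_drop[OF sol] wf_solution_pressure_drop[OF sol'] p mn
      by (metis diff_diff_eq2 diff_add_eq diff_diff_add add.commute)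
    then show ?thesis
      using strict_mono_on_diff_mult_pos[OF strict_mono_on_head_loss[OF p]
          wf_solution_flow_range[OF sol p] wf_solution_flow_range[OF sol' p] \<open>f p \<noteq> f' p\<close>] mn
      by simp
  qed
  then have nonneg: "0 \<le> ?t p" if "p \<in> edges W" for p
    using that by (cases "f p = f' p") (force split: prod.splits)+
  have "(\<Sum>p\<in>edges W. ?t p) = (\<Sum>k\<in>nodes W. (\<Sum>p\<in>edges W. incidence W p k * ?F p) * ?H k)"
    by (rule power_balance)
  also have "\<dots> = (\<Sum>k\<in>nodes W. (d k - d' k) * ?H k)"
    using sol sol' by (simp add: wf_solution_def right_diff_distrib sum_subtractf)
  also have "\<dots> = 0"
    using data by (intro sum.neutral) auto
  finally have "(\<Sum>p\<in>edges W. ?t p) = 0" .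
  then have "\<forall>p\<in>edges W. ?t p = 0"
    using nonneg network.pair_finite_arcs by (subst (asm) sum_nonneg_eq_0_iff) auto
  then show "f p = f' p" if "p \<in> edges W" for p
    using pos that by fastforce
qed

lemma constant_on_nodes:
  assumes "\<And>m n. (m, n) \<in> edges W \<Longrightarrow> y m = y n"
    and u: "u \<in> nodes W" and v: "v \<in> nodes W"
  shows "y u = y v"
proof -
  have "u \<rightarrow>\<^sup>*\<^bsub>with_proj (mk_symmetric (with_proj (network W)))\<^esub> v"
    using connected u v by (auto simp: connected_def strongly_connected_def)
  then show ?thesis
    unfolding reachable_def
    by (induction rule: rtrancl_on_induct) (auto simp: parcs_mk_symmetric dest: assms(1))
qed

lemma wf_solution_unique:
  assumes sol: "wf_solution W d f h" and sol': "wf_solution W d' f' h'"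
    and data: "\<And>k. k \<in> nodes W \<Longrightarrow> d k = d' k \<or> h k = h' k"
    and r: "r \<in> nodes W" "h r = h' r"
  shows "d = d'" "f = f'" "h = h'"
proof -
  show f: "f = f'"
    using wf_solution_flow_unique[OF sol sol' data] .
  show "d = d'"
  proof (rule extensionalityI)
    show "d \<in> extensional (nodes W)" "d' \<in> extensional (nodes W)"
      using sol sol' by (auto simp: wf_solution_def PiE_def)
    show "d k = d' k" if "k \<in> nodes W" for k
      using sol sol' f that by (auto simp: wf_solution_def)
  qed
  show "h = h'"
  proof (rule extensionalityI)
    show "h \<in> extensional (nodes W)" "h' \<in> extensional (nodes W)"
      using sol sol' by (auto simp: wf_solution_def PiE_def)
    have edge: "h m - h' m = h n - h' n" if "(m, n) \<in> edges W" for m n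
      using wf_solution_pressure_drop[OF sol that] wf_solution_pressure_drop[OF sol' that] f
      by simp
    show "h k = h' k" if "k \<in> nodes W" for k
      using constant_on_nodes[of "\<lambda>k. h k - h' k", OF edge that r(1)] r(2) by simp
  qed
qed

end

theorem proposition1:
  fixes W :: "'v wds" and N\<^sub>r :: "'v set" and h\<^sub>0 d\<^sub>0 :: "'v \<Rightarrow> real"
  assumes "water_distribution_system W"
    and "N\<^sub>r \<subseteq> nodes W" and "N\<^sub>r \<noteq> {}"
  shows "\<exists>\<^sub>\<le>\<^sub>1 (d, f, h). wf_solution W d f h \<and>
           (\<forall>i\<in>N\<^sub>r. h i = h\<^sub>0 i) \<and> (\<forall>i\<in>nodes W - N\<^sub>r. d i = d\<^sub>0 i)"
proof (rule Uniq_I, clarsimp)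
  interpret water_distribution_system W
    by fact
  obtain r where r: "r \<in> N\<^sub>r"
    using \<open>N\<^sub>r \<noteq> {}\<close> by blast
  fix d' f' h' d f h
  assume sol: "wf_solution W d f h" and sol': "wf_solution W d' f' h'"
    and h: "\<forall>i\<in>N\<^sub>r. h i = h\<^sub>0 i" and h': "\<forall>i\<in>N\<^sub>r. h' i = h\<^sub>0 i"
    and d: "\<forall>i\<in>nodes W - N\<^sub>r. d i = d\<^sub>0 i" and d': "\<forall>i\<in>nodes W - N\<^sub>r. d' i = d\<^sub>0 i"
  have "d k = d' k \<or> h k = h' k" if "k \<in> nodes W" for k
    using h h' d d' that by (cases "k \<in> N\<^sub>r") auto
  moreover have "r \<in> nodes W" "h r = h' r"
    using r h h' \<open>N\<^sub>r \<subseteq> nodes W\<close> by auto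
  ultimately show "d = d' \<and> f = f' \<and> h = h'"
    using wf_solution_unique[OF sol sol'] by blast
qed

end
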